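(* The Euclidean algebra $\mathfrak e(3)$, the Poincaré algebra $\mathfrak e(2,1)$ and the Galilean algebra $\mathcal G(3,1)$ admit complex structures such that (1) the complex structures on $\mathfrak e(3)$ and $\mathfrak e(2,1)$ are deformations of a regular complex structure on $\mathfrak{sl}(2,\mathbb C)$ (viewed as a real $6$-dimensional Lie algebra); (2) the natural embedding $\mathfrak e(3)\hookrightarrow \mathcal G(3,1)$ is holomorphic, i.e. it intertwines the complex structures on $\mathfrak e(3)$ and $\mathcal G(3,1)$.
   Context: A complex structure on a real Lie algebra $\mathfrak g$ is a real endomorphism $J$ with $J^2=-1$ and $N_J\equiv 0$ (i.e. $J$ is integrable), where $N_J(x,y)=J[x,y]-[Jx,y]-[x,Jy]-J[Jx,Jy]$. Equivalently, the $i$-eigenspace $\mathfrak g^{1,0}$ of $J$ in $\mathfrak g^{\mathbb C}=\mathfrak g\otimes_{\mathbb R}\mathbb C$ is a complex Lie subalgebra. For a representation $\rho:\mathfrak g\to\mathfrak{gl}(\mathfrak v)$, $\mathfrak g\oplus_\rho\mathfrak v$ is the semidirect product with bracket $[(x,u),(y,v)]=([x,y],\rho(x)v-\rho(y)u)$. Then $\mathfrak e(3)=\mathfrak{so}(3)\oplus_\rho\mathbb R^3$ and $\mathfrak e(2,1)=\mathfrak{so}(2,1)\oplus_\rho\mathbb R^{2,1}$, with $\rho$ the standard representations (matrices acting on column vectors), where $\mathfrak{so}(2,1)$ is the Lie algebra of the Lorentz group of $\mathbb R^{2,1}$ (form $\mathrm{diag}(1,1,-1)$). The Galilean algebra is the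 Lie algebra of real $5\times5$ matrices $$\mathcal G(3,1)=\left\{\begin{pmatrix} A & v & x\\ 0&0&t\\ 0&0&0\end{pmatrix}: A\in\mathfrak{so}(3),\ v,x\in\mathbb R^3 \text{ (columns)},\ t\in\mathbb R\right\},$$ and the natural embedding $\mathfrak e(3)\hookrightarrow\mathcal G(3,1)$ has as image the matrices with $v=0$, $t=0$ ($A$ the rotation part, $x$ the translation part). A complex structure $J$ on a reductive real Lie algebra $\mathfrak g$ is regular (in the sense of D. Snow) if there is a Cartan subalgebra $\mathfrak h$ of $\mathfrak g$ with $[\mathfrak h,\mathfrak g^{1,0}]\subset\mathfrak g^{1,0}$. A complex structure $J_0$ on a Lie algebra $\mathfrak g_0$ is a deformation of a complex structure $J_1$ on $\mathfrak g_1$ if there are a real vector space $V$, an endomorphism $J$ of $V$ with $J^2=-1$, and a continuous family of Lie brackets $\mu_t$ on $V$, $t\in[0,1]$, such that $J$ is integrable on $(V,\mu_t)$ for all $t$, $(V,\mu_t)\cong\mathfrak g_1$ for all $t\in(0,1]$, $(V,\mu_1,J)\cong(\mathfrak g_1,J_1)$ and $(V,\mu_0,J)\cong(\mathfrak g_0,J_0)$. *)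

theory Defs
  imports "HOL-Analysis.Analysis"
begin

record 'a lie_alg =
  lie_carrier :: "'a set"
  lie_bracket :: "'a \<Rightarrow> 'a \<Rightarrow> 'a"

definition linear_on_set :: "'a::real_vector set \<Rightarrow> ('a \<Rightarrow> 'b::real_vector) \<Rightarrow> bool" where
  "linear_on_set S f \<longleftrightarrow>
     (\<forall>x\<in>S. \<forall>y\<in>S. f (x + y) = f x + f y) \<and> (\<forall>c. \<forall>x\<in>S. f (c *\<^sub>R x) = c *\<^sub>R f x)"

definition real_lie_algebra :: "'a::real_vector lie_alg \<Rightarrow> bool" where
  "real_lie_algebra g \<longleftrightarrow> (let L = lie_carrier g; br = lie_bracket g in
     subspace L \<and>
     (\<forall>x\<in>L. \<forall>y\<in>L. br x y \<in> L) \<and>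
     (\<forall>x\<in>L. linear_on_set L (br x)) \<and>
     (\<forall>y\<in>L. linear_on_set L (\<lambda>x. br x y)) \<and>
     (\<forall>x\<in>L. br x x = 0) \<and>
     (\<forall>x\<in>L. \<forall>y\<in>L. \<forall>z\<in>L. br x (br y z) + br y (br z x) + br z (br x y) = 0))"

definition lie_hom ::
  "'a::real_vector lie_alg \<Rightarrow> 'b::real_vector lie_alg \<Rightarrow> ('a \<Rightarrow> 'b) \<Rightarrow> bool" where
  "lie_hom g g' f \<longleftrightarrow>
     f ` lie_carrier g \<subseteq> lie_carrier g' \<and> linear_on_set (lie_carrier g) f \<and>
     (\<forall>x\<in>lie_carrier g. \<forall>y\<in>lie_carrier g.
        f (lie_bracket g x y) = lie_bracket g' (f x) (f y))"

definition lie_iso ::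
  "'a::real_vector lie_alg \<Rightarrow> 'b::real_vector lie_alg \<Rightarrow> ('a \<Rightarrow> 'b) \<Rightarrow> bool" where
  "lie_iso g g' f \<longleftrightarrow> lie_hom g g' f \<and> bij_betw f (lie_carrier g) (lie_carrier g')"

definition lie_subalgebra :: "'a::real_vector lie_alg \<Rightarrow> 'a set \<Rightarrow> bool" where
  "lie_subalgebra g h \<longleftrightarrow> subspace h \<and> h \<subseteq> lie_carrier g \<and>
     (\<forall>x\<in>h. \<forall>y\<in>h. lie_bracket g x y \<in> h)"

definition lie_ideal :: "'a::real_vector lie_alg \<Rightarrow> 'a set \<Rightarrow> bool" where
  "lie_ideal g a \<longleftrightarrow> subspace a \<and> a \<subseteq> lie_carrier g \<and>
     (\<forall>x\<in>lie_carrier g. \<forall>y\<in>a. lie_bracket g x y \<in> a)"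

definition reductive_lie_algebra :: "'a::real_vector lie_alg \<Rightarrow> bool" where
  "reductive_lie_algebra g \<longleftrightarrow> real_lie_algebra g \<and>
     (\<forall>a. lie_ideal g a \<longrightarrow>
        (\<exists>b. lie_ideal g b \<and> a \<inter> b = {0} \<and> {x + y |x y. x \<in> a \<and> y \<in> b} = lie_carrier g))"

primrec lower_central_series :: "'a::real_vector lie_alg \<Rightarrow> nat \<Rightarrow> 'a set" where
  "lower_central_series g 0 = lie_carrier g"
| "lower_central_series g (Suc n) =
     span {lie_bracket g x y |x y. x \<in> lie_carrier g \<and> y \<in> lower_central_series g n}"

definition nilpotent_lie_algebra :: "'a::real_vector lie_alg \<Rightarrow> bool" where
  "nilpotent_lie_algebra g \<longleftrightarrow> (\<exists>n. lower_central_series g n = {0})"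

definition lie_normalizer :: "'a::real_vector lie_alg \<Rightarrow> 'a set \<Rightarrow> 'a set" where
  "lie_normalizer g h = {x \<in> lie_carrier g. \<forall>y\<in>h. lie_bracket g x y \<in> h}"

definition cartan_subalgebra :: "'a::real_vector lie_alg \<Rightarrow> 'a set \<Rightarrow> bool" where
  "cartan_subalgebra g h \<longleftrightarrow> lie_subalgebra g h \<and>
     nilpotent_lie_algebra \<lparr>lie_carrier = h, lie_bracket = lie_bracket g\<rparr> \<and>
     lie_normalizer g h = h"

definition nijenhuis :: "'a::real_vector lie_alg \<Rightarrow> ('a \<Rightarrow> 'a) \<Rightarrow> 'a \<Rightarrow> 'a \<Rightarrow> 'a" where
  "nijenhuis g J x y =
     J (lie_bracket g x y) - lie_bracket g (J x) y - lie_bracket g x (J y)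
       - J (lie_bracket g (J x) (J y))"

text \<open>Only the values of \<open>J\<close> on the carrier matter.\<close>

definition complex_structure :: "'a::real_vector lie_alg \<Rightarrow> ('a \<Rightarrow> 'a) \<Rightarrow> bool" where
  "complex_structure g J \<longleftrightarrow> real_lie_algebra g \<and>
     J ` lie_carrier g \<subseteq> lie_carrier g \<and> linear_on_set (lie_carrier g) J \<and>
     (\<forall>x\<in>lie_carrier g. J (J x) = - x) \<and>
     (\<forall>x\<in>lie_carrier g. \<forall>y\<in>lie_carrier g. nijenhuis g J x y = 0)"

text \<open>The complexification consists of the pairs \<open>(x, y)\<close>, read as \<open>x + i y\<close>; thus
  multiplication by \<open>i\<close> sends \<open>(x, y)\<close> to \<open>(- y, x)\<close>, and \<open>x\<close> in the real Lie algebra is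
  identified with \<open>(x, 0)\<close>.\<close>

definition complexification :: "'a::real_vector lie_alg \<Rightarrow> ('a \<times> 'a) lie_alg" where
  "complexification g =
     \<lparr>lie_carrier = lie_carrier g \<times> lie_carrier g,
      lie_bracket = (\<lambda>(x, y) (u, v).
        (lie_bracket g x u - lie_bracket g y v, lie_bracket g x v + lie_bracket g y u))\<rparr>"

definition mult_ii :: "'a::real_vector \<times> 'a \<Rightarrow> 'a \<times> 'a" where
  "mult_ii = (\<lambda>(x, y). (- y, x))"

definition holomorphic_part :: "'a::real_vector lie_alg \<Rightarrow> ('a \<Rightarrow> 'a) \<Rightarrow> ('a \<times> 'a) set" where
  "holomorphic_part g J =
     {z \<in> lie_carrier (complexification g). map_prod J J z = mult_ii z}"

definition regular_complex_structure :: "'a::real_vector lie_alg \<Rightarrow> ('a \<Rightarrow> 'a) \<Rightarrow> bool" where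
  "regular_complex_structure g J \<longleftrightarrow> reductive_lie_algebra g \<and> complex_structure g J \<and>
     (\<exists>h. cartan_subalgebra g h \<and>
        (\<forall>x\<in>h. \<forall>z\<in>holomorphic_part g J.
           lie_bracket (complexification g) (x, 0) z \<in> holomorphic_part g J))"

definition holomorphic_lie_embedding ::
  "'a::real_vector lie_alg \<Rightarrow> ('a \<Rightarrow> 'a) \<Rightarrow>
   'b::real_vector lie_alg \<Rightarrow> ('b \<Rightarrow> 'b) \<Rightarrow> ('a \<Rightarrow> 'b) \<Rightarrow> bool" where
  "holomorphic_lie_embedding g J g' J' f \<longleftrightarrow>
     lie_hom g g' f \<and> inj_on f (lie_carrier g) \<and>
     (\<forall>x\<in>lie_carrier g. f (J x) = J' (f x))"

text \<open>\<open>(g0, J0)\<close> is a deformation of \<open>(g1, J1)\<close>. The vector space \<open>V\<close> is isomorphic to the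
  underlying space of \<open>g0\<close>, so there is no loss in looking for it among the subspaces of the
  type of \<open>g0\<close>. As \<open>V\<close> is finite-dimensional, a family of brackets is continuous iff all its
  evaluations at pairs of vectors are.\<close>

definition deformation_of ::
  "'a::euclidean_space lie_alg \<Rightarrow> ('a \<Rightarrow> 'a) \<Rightarrow>
   'b::euclidean_space lie_alg \<Rightarrow> ('b \<Rightarrow> 'b) \<Rightarrow> bool" where
  "deformation_of g0 J0 g1 J1 \<longleftrightarrow>
     (\<exists>(V :: 'a set) (J :: 'a \<Rightarrow> 'a) (\<mu> :: real \<Rightarrow> 'a \<Rightarrow> 'a \<Rightarrow> 'a).
        let g = (\<lambda>t. \<lparr>lie_carrier = V, lie_bracket = \<mu> t\<rparr>) in
        (\<forall>t\<in>{0..1}. complex_structure (g t) J) \<and>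
        (\<forall>x\<in>V. \<forall>y\<in>V. continuous_on {0..1} (\<lambda>t. \<mu> t x y)) \<and>
        (\<forall>t\<in>{0<..1}. \<exists>f. lie_iso (g t) g1 f) \<and>
        (\<exists>f. lie_iso (g 1) g1 f \<and> (\<forall>x\<in>V. f (J x) = J1 (f x))) \<and>
        (\<exists>f. lie_iso (g 0) g0 f \<and> (\<forall>x\<in>V. f (J x) = J0 (f x))))"

definition matrix_lie_alg :: "('k::ring_1 ^ 'n ^ 'n) set \<Rightarrow> ('k ^ 'n ^ 'n) lie_alg" where
  "matrix_lie_alg S = \<lparr>lie_carrier = S, lie_bracket = (\<lambda>A B. A ** B - B ** A)\<rparr>"

definition semidirect_product ::
  "'a::real_vector lie_alg \<Rightarrow> 'v::real_vector set \<Rightarrow> ('a \<Rightarrow> 'v \<Rightarrow> 'v) \<Rightarrow> ('a \<times> 'v) lie_alg" where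
  "semidirect_product g V \<rho> =
     \<lparr>lie_carrier = lie_carrier g \<times> V,
      lie_bracket = (\<lambda>(x, u) (y, v). (lie_bracket g x y, \<rho> x v - \<rho> y u))\<rparr>"

definition sl2C :: "(complex ^ 2 ^ 2) lie_alg" where
  "sl2C = matrix_lie_alg {A. trace A = 0}"

definition so3 :: "(real ^ 3 ^ 3) lie_alg" where
  "so3 = matrix_lie_alg {A. transpose A = - A}"

definition lorentz_form :: "real ^ 3 ^ 3" where
  "lorentz_form = (\<chi> i j. if i = j then (if i = 3 then - 1 else 1) else 0)"

definition so21 :: "(real ^ 3 ^ 3) lie_alg" where
  "so21 = matrix_lie_alg {A. transpose A ** lorentz_form + lorentz_form ** A = 0}"

definition e3 :: "((real ^ 3 ^ 3) \<times> (real ^ 3)) lie_alg" where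
  "e3 = semidirect_product so3 UNIV (*v)"

definition e21 :: "((real ^ 3 ^ 3) \<times> (real ^ 3)) lie_alg" where
  "e21 = semidirect_product so21 UNIV (*v)"

definition galilean_matrix ::
  "real ^ 3 ^ 3 \<Rightarrow> real ^ 3 \<Rightarrow> real ^ 3 \<Rightarrow> real \<Rightarrow> real ^ 5 ^ 5" where
  "galilean_matrix A v x t = vector
    [vector [A $ 1 $ 1, A $ 1 $ 2, A $ 1 $ 3, v $ 1, x $ 1],
     vector [A $ 2 $ 1, A $ 2 $ 2, A $ 2 $ 3, v $ 2, x $ 2],
     vector [A $ 3 $ 1, A $ 3 $ 2, A $ 3 $ 3, v $ 3, x $ 3],
     vector [0, 0, 0, 0, t],
     vector [0, 0, 0, 0, 0]]"

definition galilean :: "(real ^ 5 ^ 5) lie_alg" where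
  "galilean = matrix_lie_alg {galilean_matrix A v x t |A v x t. A \<in> lie_carrier so3}"

definition e3_to_galilean :: "(real ^ 3 ^ 3) \<times> (real ^ 3) \<Rightarrow> real ^ 5 ^ 5" where
  "e3_to_galilean = (\<lambda>(A, x). galilean_matrix A 0 x 0)"

end

theory Submission
  imports Defs
begin

text \<open>
Extend the brackets of \<open>so(3)\<close> and \<open>so(2,1)\<close>, in a basis \<open>e\<^sub>1, e\<^sub>2, e\<^sub>3\<close> with \<open>e\<^sub>3\<close> compact, bilinearly to
the scalars \<open>\<real>[\<delta>]\<close> with \<open>\<delta>\<^sup>2 = - t\<^sup>2\<close>, and put \<open>f\<^sub>k = \<delta> e\<^sub>k\<close>. For \<open>t \<noteq> 0\<close> the scalars are the complex
numbers, and both families give the complexification \<open>sl(2,\<complex>)\<close> (\<open>lie_iso_sl2C\<close>). At \<open>t = 0\<close> the \<open>f\<^sub>k\<close>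
span an abelian ideal on which the orthogonal algebra acts by its adjoint representation, which in
dimension three is its standard one, so the limits are \<open>e(3)\<close> and \<open>e(2,1)\<close> (\<open>lie_iso_semidirect\<close>).

The operator \<open>e\<^sub>1 \<mapsto> e\<^sub>2\<close>, \<open>f\<^sub>1 \<mapsto> f\<^sub>2\<close>, \<open>e\<^sub>3 \<mapsto> f\<^sub>3\<close> does not involve \<open>t\<close> and is integrable for every \<open>t\<close>:
its \<open>(1,0)\<close>-space is spanned by two commuting vectors \<open>e\<^sub>1 - i e\<^sub>2\<close>, \<open>f\<^sub>1 - i f\<^sub>2\<close> and by \<open>e\<^sub>3 - i f\<^sub>3\<close>,
which acts on their span (\<open>complex_structure_orth_alg\<close>). At \<open>t = 1\<close> it becomes, for both families,
the complex linear operator on \<open>sl(2,\<complex>)\<close> that is \<open>i\<close> on one Borel subalgebra and \<open>- i\<close> on the opposite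
root space. It commutes with the diagonal Cartan subalgebra and is therefore regular
(\<open>regular_sl2C_J\<close>); regularity also asks for a reductive algebra, and \<open>sl(2,\<complex>)\<close> is even simple over
the reals (\<open>sl2C_ideal_trivial\<close>).

In the Galilean algebra the same recipe is applied once more: the boosts and the time translation
\<open>\<tau>\<close> get \<open>v\<^sub>1 \<mapsto> v\<^sub>2\<close>, \<open>v\<^sub>3 \<mapsto> \<tau>\<close>, while the Euclidean part keeps its structure, so the inclusion is
holomorphic by construction (\<open>complex_structure_galilei_alg\<close>, \<open>holomorphic_orth_galilei\<close>).
All this takes place in coordinates and is then moved to the matrix algebras along isomorphisms.
\<close>

section \<open>Transport of structures along isomorphisms\<close>

lemma linear_on_UNIV: "linear_on_set UNIV f \<longleftrightarrow> linear f"
  by (auto simp: linear_on_set_def linear_iff)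

lemma lie_homD:
  assumes "lie_hom g g' f" "x \<in> lie_carrier g"
  shows "f x \<in> lie_carrier g'" "f (c *\<^sub>R x) = c *\<^sub>R f x"
    "y \<in> lie_carrier g \<Longrightarrow> f (x + y) = f x + f y"
    "y \<in> lie_carrier g \<Longrightarrow> f (lie_bracket g x y) = lie_bracket g' (f x) (f y)"
  using assms by (auto simp: lie_hom_def linear_on_set_def)

lemma real_lie_algebraD:
  assumes "real_lie_algebra g"
  shows "subspace (lie_carrier g)"
    "x \<in> lie_carrier g \<Longrightarrow> y \<in> lie_carrier g \<Longrightarrow> lie_bracket g x y \<in> lie_carrier g"
  using assms by (auto simp: real_lie_algebra_def Let_def)

lemma lie_hom_comp:
  assumes "lie_hom g g' f" "lie_hom g' g'' h"
  shows "lie_hom g g'' (h \<circ> f)"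
  using assms by (auto simp: lie_hom_def linear_on_set_def image_subset_iff)

lemma lie_iso_comp:
  assumes "lie_iso g g' f" "lie_iso g' g'' h"
  shows "lie_iso g g'' (h \<circ> f)"
  using assms lie_hom_comp[of g g' f g'' h] bij_betw_trans unfolding lie_iso_def by blast

lemma lie_iso_inverse:
  assumes g: "real_lie_algebra g" and f: "lie_iso g g' f"
  shows "lie_iso g' g (inv_into (lie_carrier g) f)"
proof -
  let ?L = "lie_carrier g" and ?h = "inv_into (lie_carrier g) f"
  have hom: "lie_hom g g' f" and bij: "bij_betw f ?L (lie_carrier g')"
    using f by (auto simp: lie_iso_def)
  have inj: "inj_on f ?L" and im: "lie_carrier g' = f ` ?L"
    using bij by (auto simp: bij_betw_def)
  note L = real_lie_algebraD[OF g]
  have hf: "?h (f x) = x" if "x \<in> ?L" for x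
    using inj that by (rule inv_into_f_f)
  have "linear_on_set (lie_carrier g') ?h"
    unfolding linear_on_set_def im
    by (auto simp: hf subspace_add[OF L(1)] subspace_scale[OF L(1)]
        simp flip: lie_homD(2,3)[OF hom])
  moreover have "?h (lie_bracket g' x y) = lie_bracket g (?h x) (?h y)"
    if "x \<in> lie_carrier g'" "y \<in> lie_carrier g'" for x y
    using that unfolding im by (auto simp: hf L(2) simp flip: lie_homD(4)[OF hom])
  ultimately have "lie_hom g' g ?h"
    by (auto simp: lie_hom_def im hf)
  then show ?thesis
    using bij_betw_inv_into[OF bij] by (simp add: lie_iso_def)
qed

text \<open>An isomorphism carries the whole structure, including the Lie algebra axioms of the target.
So the axioms need to be checked only for models on coordinate spaces, where they are polynomial
identities, and never for matrices.\<close>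

lemma complex_structure_transport:
  assumes g: "complex_structure g J" and f: "lie_iso g g' f"
    and J': "\<And>x. x \<in> lie_carrier g \<Longrightarrow> J' (f x) = f (J x)"
  shows "complex_structure g' J'"
proof -
  let ?L = "lie_carrier g"
  have g': "real_lie_algebra g" and hom: "lie_hom g g' f" and im: "lie_carrier g' = f ` ?L"
    using g f by (auto simp: complex_structure_def lie_iso_def bij_betw_def)
  note L = real_lie_algebraD[OF g']
  note sub = subspace_0[OF L(1)] subspace_add[OF L(1)] subspace_scale[OF L(1)]
    subspace_diff[OF L(1)] subspace_neg[OF L(1)]
  have f0: "f 0 = 0"
    using lie_homD(2)[OF hom sub(1), of 0] by simp
  have add: "f x + f y = f (x + y)" if "x \<in> ?L" "y \<in> ?L" for x y
    using lie_homD(3)[OF hom that] by simp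
  have scale: "c *\<^sub>R f x = f (c *\<^sub>R x)" if "x \<in> ?L" for c x
    using lie_homD(2)[OF hom that] by simp
  have neg: "- f x = f (- x)" if "x \<in> ?L" for x
    using scale[OF that, of "-1"] by simp
  have diff: "f x - f y = f (x - y)" if "x \<in> ?L" "y \<in> ?L" for x y
    using add[OF that(1) sub(5)[OF that(2)]] by (simp flip: neg[OF that(2)])
  have br: "lie_bracket g' (f x) (f y) = f (lie_bracket g x y)" if "x \<in> ?L" "y \<in> ?L" for x y
    using lie_homD(4)[OF hom that] by simp
  have JL: "J x \<in> ?L" if "x \<in> ?L" for x
    using g that by (auto simp: complex_structure_def)
  note push = add scale neg diff br J' L(2) JL sub
  have "subspace (f ` ?L)"
    unfolding subspace_def using f0 sub by (auto simp: add scale)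
  moreover have "real_lie_algebra g'" if "subspace (f ` ?L)"
    using that g' unfolding real_lie_algebra_def Let_def im linear_on_set_def
    by (simp add: push f0)
  moreover have "complex_structure g' J'" if "real_lie_algebra g'"
    using that g unfolding complex_structure_def im linear_on_set_def nijenhuis_def
    by (auto simp: push f0)
  ultimately show ?thesis by blast
qed

text \<open>The family \<open>m\<close> lives on a space of its own, whereas the definition of a deformation wants brackets
on a subspace of the type of \<open>g0\<close>. The isomorphism \<open>F\<close> at parameter \<open>0\<close> moves the entire family onto
the carrier of \<open>g0\<close>; there the bracket at \<open>0\<close> becomes that of \<open>g0\<close> itself, and the continuity in
the parameter survives because \<open>F\<close> is linear on a finite-dimensional space.\<close>

lemma deformation_ofI:
  fixes m :: "real \<Rightarrow> 'c::euclidean_space lie_alg"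
    and g0 :: "'a::euclidean_space lie_alg" and g1 :: "'b::euclidean_space lie_alg"
  assumes UN: "\<And>t. lie_carrier (m t) = UNIV"
    and cs: "\<And>t. complex_structure (m t) J"
    and cont: "\<And>x y. continuous_on {0..1} (\<lambda>t. lie_bracket (m t) x y)"
    and iso1: "\<And>t. 0 < t \<Longrightarrow> t \<le> 1 \<Longrightarrow> lie_iso (m t) g1 (\<phi> t)"
    and J1: "\<And>x. \<phi> 1 (J x) = J1 (\<phi> 1 x)"
    and iso0: "lie_iso (m 0) g0 F"
    and J0: "\<And>x. F (J x) = J0 (F x)"
  shows "deformation_of g0 J0 g1 J1"
proof -
  define br where "br = (\<lambda>t X Y. F (lie_bracket (m t) (inv F X) (inv F Y)))"
  define gt where "gt = (\<lambda>t. \<lparr>lie_carrier = lie_carrier g0, lie_bracket = br t\<rparr>)"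
  have hom: "lie_hom (m 0) g0 F" and bij: "bij_betw F UNIV (lie_carrier g0)"
    using iso0 by (auto simp: lie_iso_def UN)
  have inj: "inj F" and im: "lie_carrier g0 = range F"
    using bij by (auto simp: bij_betw_def)
  have inv [simp]: "inv F (F x) = x" for x
    using inj by simp
  have linF: "linear F"
    using lie_homD[OF hom] by (intro linearI) (auto simp: UN)
  have iso_t: "lie_iso (m t) (gt t) F" for t
    using hom bij by (auto simp: lie_iso_def lie_hom_def gt_def br_def UN)
  have inv_iso: "lie_iso (gt t) (m t) (inv F)" for t
    using lie_iso_inverse[OF _ iso_t[of t]] cs[of t] by (simp add: UN complex_structure_def)
  have iso_gt: "lie_iso (gt t) g1 (\<phi> t \<circ> inv F)" if "t \<in> {0<..1}" for t
    using lie_iso_comp[OF inv_iso iso1] that by auto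
  have "complex_structure (gt t) J0" for t
    by (rule complex_structure_transport[OF cs iso_t]) (simp add: J0)
  moreover have "continuous_on {0..1} (\<lambda>t. br t X Y)" for X Y
    unfolding br_def
    by (rule bounded_linear.continuous_on[OF linear_conv_bounded_linear[THEN iffD1, OF linF] cont])
  moreover have "\<exists>f. lie_iso (gt t) g1 f" if "t \<in> {0<..1}" for t
    using iso_gt[OF that] by blast
  moreover have "\<exists>f. lie_iso (gt 1) g1 f \<and> (\<forall>X\<in>lie_carrier g0. f (J0 X) = J1 (f X))"
    using iso_gt[of 1] J1 by (intro exI[of _ "\<phi> 1 \<circ> inv F"]) (auto simp: im simp flip: J0)
  moreover have "lie_iso (gt 0) g0 id"
    using lie_homD(4)[OF hom]
    by (auto simp: lie_iso_def lie_hom_def linear_on_set_def gt_def br_def im UN)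
  ultimately show ?thesis
    unfolding deformation_of_def
    by (intro exI[of _ "lie_carrier g0"] exI[of _ J0] exI[of _ br])
      (auto simp: Let_def simp flip: gt_def intro!: exI[of _ id])
qed

lemma holomorphic_lie_embedding_transport:
  assumes h: "holomorphic_lie_embedding g J g' J' h"
    and f: "lie_iso g k f" and f': "lie_iso g' k' f'"
    and g: "real_lie_algebra g"
    and sq: "\<And>x. x \<in> lie_carrier g \<Longrightarrow> h' (f x) = f' (h x)"
    and K: "\<And>x. x \<in> lie_carrier g \<Longrightarrow> J x \<in> lie_carrier g \<and> K (f x) = f (J x)"
    and K': "\<And>x. x \<in> lie_carrier g' \<Longrightarrow> K' (f' x) = f' (J' x)"
  shows "holomorphic_lie_embedding k K k' K' h'"
proof -
  let ?L = "lie_carrier g"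
  have hom: "lie_hom g g' h" and inj: "inj_on h ?L" and hJ: "\<And>x. x \<in> ?L \<Longrightarrow> h (J x) = J' (h x)"
    using h by (auto simp: holomorphic_lie_embedding_def)
  have homf: "lie_hom g k f" and im: "lie_carrier k = f ` ?L" and homf': "lie_hom g' k' f'"
    and injf': "inj_on f' (lie_carrier g')"
    using f f' by (auto simp: lie_iso_def bij_betw_def)
  note L = real_lie_algebraD[OF g]
  note sub = subspace_add[OF L(1)] subspace_scale[OF L(1)]
  note D = lie_homD[OF homf] lie_homD[OF homf'] lie_homD[OF hom]
  have "lie_hom k k' h'"
    unfolding lie_hom_def linear_on_set_def im
    by (auto simp: sq sub L(2) D(1,5,9) simp flip: D(2-4)) (simp_all add: D)
  moreover have "inj_on h' (lie_carrier k)"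
    unfolding im
  proof (rule inj_onI, clarsimp simp: sq)
    fix x y assume xy: "x \<in> ?L" "y \<in> ?L" and "f' (h x) = f' (h y)"
    then have "h x = h y"
      using injf' D(9) by (meson inj_onD)
    then show "f x = f y"
      using inj xy by (auto dest: inj_onD)
  qed
  ultimately show ?thesis
    by (auto simp: holomorphic_lie_embedding_def im K K' sq hJ D)
qed

section \<open>A common model of the orthogonal and Euclidean algebras\<close>

lemma vec3_eq_iff: "(x :: 'a ^ 3) = y \<longleftrightarrow> x $ 1 = y $ 1 \<and> x $ 2 = y $ 2 \<and> x $ 3 = y $ 3"
  by (auto simp: vec_eq_iff forall_3)

text \<open>This is \<open>Q (a \<times> b)\<close> for \<open>Q = diag(1, 1, \<epsilon>)\<close>. With basis \<open>e\<^sub>1, e\<^sub>2, e\<^sub>3\<close> it reads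
\<open>[e\<^sub>1, e\<^sub>2] = \<epsilon> e\<^sub>3\<close>, \<open>[e\<^sub>2, e\<^sub>3] = e\<^sub>1\<close>, \<open>[e\<^sub>3, e\<^sub>1] = e\<^sub>2\<close>: the Lie algebra \<open>so(3)\<close> for
\<open>\<epsilon> = 1\<close> and \<open>so(2,1)\<close> for \<open>\<epsilon> = - 1\<close>. In both cases \<open>e\<^sub>3\<close> generates a compact subgroup.\<close>

definition twisted_cross :: "real \<Rightarrow> real ^ 3 \<Rightarrow> real ^ 3 \<Rightarrow> real ^ 3" where
  "twisted_cross \<epsilon> a b = vector
     [a $ 2 * b $ 3 - a $ 3 * b $ 2, a $ 3 * b $ 1 - a $ 1 * b $ 3,
      \<epsilon> * (a $ 1 * b $ 2 - a $ 2 * b $ 1)]"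

lemma twisted_cross_nth [simp]:
  "twisted_cross \<epsilon> a b $ 1 = a $ 2 * b $ 3 - a $ 3 * b $ 2"
  "twisted_cross \<epsilon> a b $ 2 = a $ 3 * b $ 1 - a $ 1 * b $ 3"
  "twisted_cross \<epsilon> a b $ 3 = \<epsilon> * (a $ 1 * b $ 2 - a $ 2 * b $ 1)"
  by (simp_all add: twisted_cross_def)

text \<open>The pair \<open>(a, u)\<close> stands for \<open>a + \<delta> u\<close>, and the bracket is the bilinear extension of the twisted
cross product to \<open>\<real>[\<delta>]\<close> with \<open>\<delta>\<^sup>2 = - t\<^sup>2\<close>. For \<open>t \<noteq> 0\<close> this ring is \<open>\<complex>\<close> with \<open>\<delta> = i t\<close>, and the
algebra is a complexification; at \<open>t = 0\<close> the second summand becomes an abelian ideal.\<close>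

definition orth_alg :: "real \<Rightarrow> real \<Rightarrow> ((real ^ 3) \<times> (real ^ 3)) lie_alg" where
  "orth_alg \<epsilon> t =
     \<lparr>lie_carrier = UNIV,
      lie_bracket = (\<lambda>(a, u) (b, v).
        (twisted_cross \<epsilon> a b - t\<^sup>2 *\<^sub>R twisted_cross \<epsilon> u v,
         twisted_cross \<epsilon> a v + twisted_cross \<epsilon> u b))\<rparr>"

text \<open>Writing \<open>f\<^sub>k\<close> for \<open>\<delta> e\<^sub>k\<close>, this is \<open>e\<^sub>1 \<mapsto> e\<^sub>2\<close>, \<open>f\<^sub>1 \<mapsto> f\<^sub>2\<close>, \<open>e\<^sub>3 \<mapsto> f\<^sub>3\<close>.\<close>

definition orth_J :: "(real ^ 3) \<times> (real ^ 3) \<Rightarrow> (real ^ 3) \<times> (real ^ 3)" where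
  "orth_J = (\<lambda>(a, u). (vector [- a $ 2, a $ 1, - u $ 3], vector [- u $ 2, u $ 1, a $ 3]))"

text \<open>The \<open>(1,0)\<close>-vectors are spanned by \<open>e\<^sub>1 - i e\<^sub>2\<close>, \<open>f\<^sub>1 - i f\<^sub>2\<close> and \<open>e\<^sub>3 - i f\<^sub>3\<close>. The brackets of the
first two vanish, and both \<open>e\<^sub>3\<close> and \<open>f\<^sub>3\<close> map their span into itself; hence integrability holds for
all \<open>\<epsilon>\<close> and \<open>t\<close> at once, in particular along the whole contraction.\<close>

lemma complex_structure_orth_alg: "complex_structure (orth_alg \<epsilon> t) orth_J"
proof -
  have "real_lie_algebra (orth_alg \<epsilon> t)"
    unfolding real_lie_algebra_def Let_def orth_alg_def
    by (auto simp: linear_on_set_def vec3_eq_iff zero_prod_def algebra_simps)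
  then show ?thesis
    unfolding complex_structure_def nijenhuis_def orth_alg_def orth_J_def
    by (auto simp: linear_on_set_def vec3_eq_iff zero_prod_def algebra_simps)
qed

section \<open>The Euclidean algebra and the Poincare algebra at parameter zero\<close>

text \<open>The matrix of the adjoint action; for \<open>\<epsilon> = 1\<close> it is the usual skew-symmetric matrix of a vector.
For \<open>\<epsilon>\<^sup>2 = 1\<close> it lies in the orthogonal algebra of the form \<open>diag(1, 1, \<epsilon>)\<close>, so that the
standard representation of that algebra is isomorphic to its adjoint one.\<close>

definition form_hat :: "real \<Rightarrow> real ^ 3 \<Rightarrow> real ^ 3 ^ 3" where
  "form_hat \<epsilon> a = matrix (twisted_cross \<epsilon> a)"

lemma form_hat_nth [simp]:
  "form_hat \<epsilon> a $ 1 $ 1 = 0" "form_hat \<epsilon> a $ 1 $ 2 = - a $ 3" "form_hat \<epsilon> a $ 1 $ 3 = a $ 2"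
  "form_hat \<epsilon> a $ 2 $ 1 = a $ 3" "form_hat \<epsilon> a $ 2 $ 2 = 0" "form_hat \<epsilon> a $ 2 $ 3 = - a $ 1"
  "form_hat \<epsilon> a $ 3 $ 1 = - \<epsilon> * a $ 2" "form_hat \<epsilon> a $ 3 $ 2 = \<epsilon> * a $ 1" "form_hat \<epsilon> a $ 3 $ 3 = 0"
  by (simp_all add: form_hat_def matrix_def axis_def)

lemma form_hat_linear:
  "form_hat \<epsilon> (a + b) = form_hat \<epsilon> a + form_hat \<epsilon> b" "form_hat \<epsilon> (c *\<^sub>R a) = c *\<^sub>R form_hat \<epsilon> a"
  by (simp_all add: vec3_eq_iff algebra_simps)

lemma form_hat_mult: "form_hat \<epsilon> a *v v = twisted_cross \<epsilon> a v"
  by (simp add: vec3_eq_iff matrix_vector_mult_def sum_3 algebra_simps)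

lemma form_hat_commutator:
  assumes "\<epsilon>\<^sup>2 = 1"
  shows "form_hat \<epsilon> (twisted_cross \<epsilon> a b) =
    form_hat \<epsilon> a ** form_hat \<epsilon> b - form_hat \<epsilon> b ** form_hat \<epsilon> a"
proof -
  have "\<epsilon> * (\<epsilon> * x) = x" for x
    using assms by (metis mult.assoc mult_1 power2_eq_square)
  then show ?thesis
    by (simp add: vec3_eq_iff matrix_matrix_mult_def sum_3 algebra_simps)
qed

lemma so3_carrier: "lie_carrier so3 = range (form_hat 1)"
proof -
  have "A \<in> range (form_hat 1)" if "transpose A = - A" for A
  proof -
    have skew: "A $ j $ i = - A $ i $ j" for i j
      using arg_cong[OF that, of "\<lambda>B. B $ i $ j"] by (simp add: transpose_def)
    have diag: "A $ i $ i = 0" for i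
      using skew[of i i] by linarith
    show ?thesis
      using diag skew[of 2 1] skew[of 1 3] skew[of 3 2]
      by (intro range_eqI[of _ _ "vector [A $ 3 $ 2, A $ 1 $ 3, A $ 2 $ 1]"])
        (simp add: vec3_eq_iff)
  qed
  moreover have "transpose (form_hat 1 a) = - form_hat 1 a" for a
    by (simp add: vec3_eq_iff transpose_def)
  ultimately show ?thesis
    by (auto simp: so3_def matrix_lie_alg_def)
qed

lemma so21_carrier: "lie_carrier so21 = range (form_hat (-1))"
proof -
  have "A \<in> range (form_hat (-1))"
    if "transpose A ** lorentz_form + lorentz_form ** A = 0" for A
    using that
    by (intro range_eqI[of _ _ "vector [- A $ 2 $ 3, A $ 1 $ 3, A $ 2 $ 1]"])
      (simp add: vec3_eq_iff transpose_def lorentz_form_def matrix_matrix_mult_def sum_3)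
  moreover have "transpose (form_hat (-1) a) ** lorentz_form + lorentz_form ** form_hat (-1) a = 0"
    for a
    by (simp add: vec3_eq_iff transpose_def lorentz_form_def matrix_matrix_mult_def sum_3)
  ultimately show ?thesis
    by (auto simp: so21_def matrix_lie_alg_def)
qed

text \<open>At \<open>t = 0\<close> the twisted cross product acts as the bracket of the orthogonal algebra on the first
summand and, by the preceding identities, as its standard representation on the second.\<close>

lemma lie_iso_semidirect:
  assumes "\<epsilon>\<^sup>2 = 1"
  shows "lie_iso (orth_alg \<epsilon> 0)
    (semidirect_product (matrix_lie_alg (range (form_hat \<epsilon>))) UNIV (*v)) (map_prod (form_hat \<epsilon>) id)"
proof -
  have "inj (form_hat \<epsilon>)"
    by (auto simp: inj_def vec3_eq_iff)
  then have "bij_betw (map_prod (form_hat \<epsilon>) id) (UNIV \<times> UNIV)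
      (range (form_hat \<epsilon>) \<times> (UNIV :: (real ^ 3) set))"
    by (intro bij_betw_map_prod) (auto simp: bij_betw_def)
  moreover have "linear (form_hat \<epsilon>)"
    by (rule linearI) (simp_all add: form_hat_linear)
  moreover have "twisted_cross \<epsilon> a v - twisted_cross \<epsilon> b u =
      twisted_cross \<epsilon> a v + twisted_cross \<epsilon> u b"
    for a b u v
    by (simp add: vec3_eq_iff algebra_simps)
  ultimately show ?thesis
    using form_hat_commutator[OF assms]
    by (auto simp: lie_iso_def lie_hom_def orth_alg_def semidirect_product_def matrix_lie_alg_def
        linear_on_set_def form_hat_mult linear_add linear_scale)
qed

lemma lie_iso_e3: "lie_iso (orth_alg 1 0) e3 (map_prod (form_hat 1) id)"
  using lie_iso_semidirect[of 1] so3_carrier by (simp add: e3_def so3_def matrix_lie_alg_def)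

lemma lie_iso_e21: "lie_iso (orth_alg (-1) 0) e21 (map_prod (form_hat (-1)) id)"
  using lie_iso_semidirect[of "-1"] so21_carrier by (simp add: e21_def so21_def matrix_lie_alg_def)

section \<open>The special linear algebra at nonzero parameters\<close>

text \<open>The matrix \<open>h H + p E + q F\<close> in the standard basis of \<open>sl(2,\<complex>)\<close>.\<close>

definition traceless :: "complex \<Rightarrow> complex \<Rightarrow> complex \<Rightarrow> complex ^ 2 ^ 2" where
  "traceless h p q = vector [vector [h, p], vector [q, - h]]"

lemma vec2_eq_iff: "(x :: 'a ^ 2) = y \<longleftrightarrow> x $ 1 = y $ 1 \<and> x $ 2 = y $ 2"
  by (auto simp: vec_eq_iff forall_2)

lemma traceless_eq_iff [simp]:
  "traceless h p q = traceless h' p' q' \<longleftrightarrow> h = h' \<and> p = p' \<and> q = q'"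
  by (auto simp: traceless_def vec2_eq_iff)

lemma traceless_nth [simp]:
  "traceless h p q $ 1 $ 1 = h" "traceless h p q $ 1 $ 2 = p"
  "traceless h p q $ 2 $ 1 = q" "traceless h p q $ 2 $ 2 = - h"
  by (simp_all add: traceless_def)

lemma traceless_arith:
  "traceless h p q + traceless h' p' q' = traceless (h + h') (p + p') (q + q')"
  "traceless h p q - traceless h' p' q' = traceless (h - h') (p - p') (q - q')"
  "c *\<^sub>R traceless h p q = traceless (c *\<^sub>R h) (c *\<^sub>R p) (c *\<^sub>R q)"
  "- traceless h p q = traceless (- h) (- p) (- q)"
  "traceless 0 0 0 = 0"
  by (auto simp: vec2_eq_iff)

lemma sl2C_carrier: "lie_carrier sl2C = {traceless h p q | h p q. True}"
proof -
  have "\<exists>h p q. A = traceless h p q" if "trace A = 0" for A :: "complex ^ 2 ^ 2"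
    using that
    by (intro exI[of _ "A $ 1 $ 1"] exI[of _ "A $ 1 $ 2"] exI[of _ "A $ 2 $ 1"])
      (auto simp: vec2_eq_iff trace_def sum_2 eq_neg_iff_add_eq_0 add.commute)
  moreover have "trace (traceless h p q) = 0" for h p q
    by (simp add: trace_def sum_2)
  ultimately show ?thesis
    unfolding sl2C_def matrix_lie_alg_def by auto
qed

lemma sl2C_bracket:
  "lie_bracket sl2C (traceless h p q) (traceless h' p' q') =
     traceless (p * q' - p' * q) (2 * (h * p' - h' * p)) (2 * (q * h' - q' * h))"
  by (simp add: sl2C_def matrix_lie_alg_def vec2_eq_iff matrix_matrix_mult_def sum_2 algebra_simps)

text \<open>A complex linear operator: \<open>i\<close> on \<open>H\<close> and \<open>F\<close>, and \<open>- i\<close> on \<open>E\<close>. The sign change on one root space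
is what distinguishes it from the multiplication by \<open>i\<close>.\<close>

definition sl2C_J :: "complex ^ 2 ^ 2 \<Rightarrow> complex ^ 2 ^ 2" where
  "sl2C_J A = traceless (\<i> * A $ 1 $ 1) (- \<i> * A $ 1 $ 2) (\<i> * A $ 2 $ 1)"

text \<open>With \<open>z = a + i t u\<close> this is \<open>z\<^sub>1 \<eta> \<sigma>\<^sub>1 + z\<^sub>2 \<eta> \<sigma>\<^sub>2 + z\<^sub>3 \<sigma>\<^sub>3\<close>, where \<open>\<sigma>\<^sub>k\<close> is \<open>- i / 2\<close> times the \<open>k\<close>-th
Pauli matrix, so that \<open>\<sigma>\<^sub>1, \<sigma>\<^sub>2, \<sigma>\<^sub>3\<close> satisfy the relations of the cross product. Multiplying the
first two by \<open>\<eta>\<close> multiplies \<open>[\<sigma>\<^sub>1, \<sigma>\<^sub>2]\<close> by \<open>\<eta>\<^sup>2\<close>: the choice \<open>\<eta> = 1\<close> gives \<open>su(2)\<close>, and \<open>\<eta> = i\<close> the other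
real form \<open>su(1,1)\<close> with the same compact Cartan subalgebra.\<close>

definition orth_to_sl2C :: "complex \<Rightarrow> real \<Rightarrow> (real ^ 3) \<times> (real ^ 3) \<Rightarrow> complex ^ 2 ^ 2" where
  "orth_to_sl2C \<eta> t = (\<lambda>(a, u).
     let z = (\<lambda>k. of_real (a $ k) + \<i> * of_real (t * u $ k)) in
     traceless (- \<i> / 2 * z 3) (- \<eta> / 2 * (\<i> * z 1 + z 2)) (- \<eta> / 2 * (\<i> * z 1 - z 2)))"

lemma lie_iso_sl2C:
  assumes \<eta>: "\<eta>\<^sup>2 = of_real \<epsilon>" "\<eta> \<noteq> 0" and t: "t \<noteq> 0"
  shows "lie_iso (orth_alg \<epsilon> t) sl2C (orth_to_sl2C \<eta> t)"
proof -
  let ?f = "orth_to_sl2C \<eta> t"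
  have "linear ?f"
    by (rule linearI)
      (auto simp: orth_to_sl2C_def Let_def traceless_arith field_simps
        scaleR_conv_of_real[where 'a = complex])
  moreover have "?f (lie_bracket (orth_alg \<epsilon> t) x y) = lie_bracket sl2C (?f x) (?f y)" for x y
  proof -
    have eps: "of_real \<epsilon> = \<eta> * \<eta>" using \<eta> by (simp add: power2_eq_square)
    have ii: "\<i> * (\<i> * x) = - x" for x by (simp add: mult.assoc[symmetric])
    show ?thesis
      by (cases x; cases y)
        (auto simp: orth_to_sl2C_def Let_def orth_alg_def sl2C_bracket eps power2_eq_square
          field_simps ii)
  qed
  moreover have "inj ?f"
  proof -
    have coord: "a = 0 \<and> b = 0" if "complex_of_real a + \<i> * of_real (t * b) = 0" for a b
      using that t by (simp add: complex_eq_iff)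
    have cancel: "u = 0 \<and> v = 0" if "\<i> * u + v = 0" "\<i> * u - v = 0" for u v :: complex
    proof -
      have "2 * (\<i> * u) = (\<i> * u + v) + (\<i> * u - v)" "2 * v = (\<i> * u + v) - (\<i> * u - v)"
        by simp_all
      then show ?thesis
        unfolding that by simp
    qed
    have "x = 0" if "?f x = 0" for x
    proof -
      obtain a u where x: "x = (a, u)" by (cases x)
      define z where "z k = complex_of_real (a $ k) + \<i> * of_real (t * u $ k)" for k
      have "z 3 = 0" "\<i> * z 1 + z 2 = 0" "\<i> * z 1 - z 2 = 0"
        using that \<eta>
        unfolding x orth_to_sl2C_def Let_def prod.case traceless_arith(5)[symmetric]
          traceless_eq_iff z_def[symmetric]
        by auto
      then have "z 1 = 0" "z 2 = 0" "z 3 = 0"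
        using cancel[of "z 1" "z 2"] by auto
      then show "x = 0"
        using coord unfolding z_def x by (auto simp: vec3_eq_iff zero_prod_def)
    qed
    then show ?thesis
      using \<open>linear ?f\<close> by (simp add: linear_injective_0)
  qed
  moreover have "range ?f = lie_carrier sl2C"
  proof -
    have "traceless h p q \<in> range ?f" for h p q
    proof -
      \<comment> \<open>The complex coordinates obtained by solving for \<open>z\<close>; real and imaginary part give \<open>a\<close> and \<open>t u\<close>.\<close>
      define w where "w = (vector [\<i> * (p + q) / \<eta>, (q - p) / \<eta>, 2 * \<i> * h] :: complex ^ 3)"
      let ?x = "(\<chi> k. Re (w $ k), \<chi> k. Im (w $ k) / t)"
      have w: "of_real (Re (w $ k)) + \<i> * of_real (t * (Im (w $ k) / t)) = w $ k" for k
        using t by (simp add: complex_eq_iff)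
      have "traceless h p q = ?f ?x"
        unfolding orth_to_sl2C_def Let_def prod.case vec_lambda_beta w using \<eta>
        by (simp add: w_def field_simps)
      then show ?thesis by blast
    qed
    then show ?thesis
      by (auto simp: sl2C_carrier orth_to_sl2C_def Let_def)
  qed
  ultimately show ?thesis
    by (auto simp: lie_iso_def lie_hom_def orth_alg_def linear_on_UNIV bij_betw_def)
qed

text \<open>Only at \<open>t = 1\<close> does the image of \<open>e\<^sub>3 \<mapsto> f\<^sub>3\<close> become the multiplication by \<open>i\<close> on the diagonal, and
the result is the same for every \<open>\<eta>\<close>: both contractions start at one complex structure.\<close>

lemma sl2C_J_intertwines: "orth_to_sl2C \<eta> 1 (orth_J x) = sl2C_J (orth_to_sl2C \<eta> 1 x)"
  by (cases x) (auto simp: orth_to_sl2C_def Let_def orth_J_def sl2C_J_def field_simps)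

lemma complex_structure_sl2C: "complex_structure sl2C sl2C_J"
  by (rule complex_structure_transport[OF complex_structure_orth_alg lie_iso_sl2C[of 1 1 1]])
    (simp_all add: sl2C_J_intertwines)

section \<open>Simplicity and regularity\<close>

text \<open>Simplicity as a real Lie algebra. Brackets with complex multiples of \<open>H\<close> already absorb complex
scalars, so a real ideal that contains one nonzero multiple of \<open>E\<close> contains every complex multiple
of \<open>E\<close>, and then everything.\<close>

lemma sl2C_ideal_trivial:
  assumes "lie_ideal sl2C a"
  shows "a = {0} \<or> a = lie_carrier sl2C"
proof -
  have sub: "subspace a" and aL: "a \<subseteq> lie_carrier sl2C"
    and br: "\<And>x y. x \<in> lie_carrier sl2C \<Longrightarrow> y \<in> a \<Longrightarrow> lie_bracket sl2C x y \<in> a"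
    using assms by (auto simp: lie_ideal_def)
  have ad: "traceless (p * q' - p' * q) (2 * (h * p' - h' * p)) (2 * (q * h' - q' * h)) \<in> a"
    if "traceless h' p' q' \<in> a" for h p q h' p' q'
    using br[OF _ that, of "traceless h p q"] by (auto simp: sl2C_carrier sl2C_bracket)
  have plus: "traceless (h + h') (p + p') (q + q') \<in> a"
    if "traceless h p q \<in> a" "traceless h' p' q' \<in> a" for h p q h' p' q'
    using subspace_add[OF sub that] by (simp add: traceless_arith)
  have all: "traceless h p q \<in> a" if E: "\<And>c. traceless 0 c 0 \<in> a" for h p q
  proof -
    have H: "traceless c 0 0 \<in> a" for c
      using ad[OF E[of c], where h = 0 and p = 0 and q = "-1"] by simp
    have F: "traceless 0 0 c \<in> a" for c
      using ad[OF H[of "c / 2"], where h = 0 and p = 0 and q = 1] by simp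
    show ?thesis
      using plus[OF plus[OF H[of h] E[of p]] F[of q]] by simp
  qed
  have "traceless h' p' q' \<in> a" if X: "traceless h p q \<in> a" "traceless h p q \<noteq> 0"
    for h p q h' p' q'
  proof -
    have "\<exists>d. d \<noteq> 0 \<and> traceless 0 d 0 \<in> a"
    proof (cases "p = 0")
      case False
      \<comment> \<open>\<open>[H, X]\<close> and \<open>[H, [H, X]]\<close> carry the \<open>F\<close>-part with opposite signs, so \<open>2 [H, X] + [H, [H, X]]\<close>
        isolates the \<open>E\<close>-part.\<close>
      have 1: "traceless 0 (2 * c * p) (- 2 * c * q) \<in> a" for c
        using ad[OF X(1), where h = c and p = 0 and q = 0] by (simp add: algebra_simps)
      have "traceless 0 (4 * p) (4 * q) \<in> a"
        using ad[OF 1[of 1], where h = 1 and p = 0 and q = 0] by simp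
      then have "traceless 0 (8 * p) 0 \<in> a"
        using plus[OF 1[of 2]] by fastforce
      then show ?thesis
        using False by (intro exI[of _ "8 * p"]) simp
    next
      case True
      \<comment> \<open>Brackets with \<open>E\<close> raise the weight: from \<open>F\<close> to \<open>H\<close>, and from \<open>H\<close> to \<open>E\<close>.\<close>
      have 1: "traceless q (- 2 * h) 0 \<in> a"
        using ad[OF X(1), where h = 0 and p = 1 and q = 0] by simp
      have 2: "traceless 0 (- 2 * q) 0 \<in> a"
        using ad[OF 1, where h = 0 and p = 1 and q = 0] by simp
      show ?thesis
      proof (cases "q = 0")
        case True
        then show ?thesis
          using 1 X(2) \<open>p = 0\<close> traceless_arith(5) by (intro exI[of _ "- 2 * h"]) auto
      next
        case False
        then show ?thesis
          using 2 by (intro exI[of _ "- 2 * q"]) auto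
      qed
    qed
    then obtain d where d: "d \<noteq> 0" "traceless 0 d 0 \<in> a" by blast
    have "traceless 0 c 0 \<in> a" for c
      using ad[OF d(2), where h = "c / (2 * d)" and p = 0 and q = 0] d(1) by simp
    then show ?thesis by (rule all)
  qed
  then have "lie_carrier sl2C \<subseteq> a" if "a \<noteq> {0}"
    using that aL subspace_0[OF sub] unfolding sl2C_carrier by blast
  then show ?thesis using aL by blast
qed

lemma reductive_sl2C: "reductive_lie_algebra sl2C"
proof -
  have alg: "real_lie_algebra sl2C"
    using complex_structure_sl2C by (simp add: complex_structure_def)
  note L = real_lie_algebraD[OF alg]
  have "lie_ideal sl2C (lie_carrier sl2C)"
    using L by (auto simp: lie_ideal_def)
  moreover have "lie_ideal sl2C {0}"
    using alg subspace_0[OF L(1)]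
    by (auto simp: lie_ideal_def real_lie_algebra_def Let_def linear_on_set_def)
      (metis scaleR_zero_left)
  moreover have "\<exists>b. lie_ideal sl2C b \<and> a \<inter> b = {0} \<and>
      {x + y |x y. x \<in> a \<and> y \<in> b} = lie_carrier sl2C"
    if "lie_ideal sl2C a" for a
    using sl2C_ideal_trivial[OF that]
  proof
    assume "a = {0}"
    then show ?thesis
      using calculation(1) subspace_0[OF L(1)] by (intro exI[of _ "lie_carrier sl2C"]) auto
  next
    assume "a = lie_carrier sl2C"
    then show ?thesis
      using calculation(2) subspace_0[OF L(1)] by (intro exI[of _ "{0}"]) auto
  qed
  ultimately show ?thesis
    using alg by (auto simp: reductive_lie_algebra_def)
qed

lemma cartan_subalgebra_diagonal: "cartan_subalgebra sl2C (range (\<lambda>h. traceless h 0 0))"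
proof -
  let ?H = "range (\<lambda>h. traceless h 0 0)"
  have "subspace ?H"
    unfolding subspace_def
  proof (intro conjI ballI allI)
    show "0 \<in> ?H" using traceless_arith(5) by (metis rangeI)
  qed (auto simp: traceless_arith)
  moreover have "?H \<subseteq> lie_carrier sl2C"
    by (auto simp: sl2C_carrier)
  moreover have br: "lie_bracket sl2C x y = 0"  if "x \<in> ?H" "y \<in> ?H" for x y
    using that by (auto simp: sl2C_bracket traceless_arith(5))
  moreover have "lower_central_series \<lparr>lie_carrier = ?H, lie_bracket = lie_bracket sl2C\<rparr> 1 = {0}"
  proof -
    have "span {lie_bracket sl2C x y |x y. x \<in> ?H \<and> y \<in> ?H} \<subseteq> {0}"
      using br by (intro span_minimal) auto
    then have "span {lie_bracket sl2C x y |x y. x \<in> ?H \<and> y \<in> ?H} = {0}"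
      using span_0 by blast
    then show ?thesis
      unfolding One_nat_def lower_central_series.simps lie_alg.simps .
  qed
  moreover have "lie_normalizer sl2C ?H = ?H"
  proof -
    \<comment> \<open>The bracket with \<open>H\<close> doubles the off-diagonal entries up to sign, so it is diagonal only if they vanish.\<close>
    have "x \<in> ?H" if "x \<in> lie_carrier sl2C"
      and norm: "lie_bracket sl2C x (traceless 1 0 0) \<in> ?H" for x
    proof -
      obtain h p q where x: "x = traceless h p q"
        using \<open>x \<in> lie_carrier sl2C\<close> by (auto simp: sl2C_carrier)
      show ?thesis
        using norm by (auto simp: x sl2C_bracket)
    qed
    moreover have "?H \<subseteq> lie_normalizer sl2C ?H"
      using br \<open>?H \<subseteq> lie_carrier sl2C\<close> subspace_0[OF \<open>subspace ?H\<close>]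
      unfolding lie_normalizer_def by auto
    ultimately show ?thesis
      unfolding lie_normalizer_def by blast
  qed
  ultimately show ?thesis
    unfolding cartan_subalgebra_def lie_subalgebra_def nilpotent_lie_algebra_def
    by (metis subspace_0)
qed

text \<open>Each root space is an eigenspace of the operator, which is complex linear; hence it commutes with
the adjoint action of the diagonal matrices.\<close>

lemma regular_sl2C_J: "regular_complex_structure sl2C sl2C_J"
proof -
  have "lie_bracket (complexification sl2C) (x, 0) z \<in> holomorphic_part sl2C sl2C_J"
    if xH: "x \<in> range (\<lambda>h. traceless h 0 0)"
      and zJ: "z \<in> holomorphic_part sl2C sl2C_J" for x z
  proof -
    obtain h where x: "x = traceless h 0 0" using xH by auto
    obtain a b c a' b' c' where z: "z = (traceless a b c, traceless a' b' c')"
      using zJ by (cases z) (auto simp: holomorphic_part_def complexification_def sl2C_carrier)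
    have zero: "lie_bracket sl2C 0 (traceless a b c) = 0" for a b c
      unfolding traceless_arith(5)[symmetric] sl2C_bracket by simp
    have ii: "\<i> * (\<i> * u) = - u" for u
      by (simp flip: mult.assoc)
    show ?thesis
      using zJ
      by (auto simp: x z zero holomorphic_part_def complexification_def mult_ii_def sl2C_carrier
          sl2C_bracket sl2C_J_def traceless_arith mult.assoc ii)
  qed
  then show ?thesis
    using reductive_sl2C complex_structure_sl2C cartan_subalgebra_diagonal
    unfolding regular_complex_structure_def by blast
qed

section \<open>The Galilean algebra\<close>

lemma exhaust_5:
  fixes x :: 5
  shows "x = 1 \<or> x = 2 \<or> x = 3 \<or> x = 4 \<or> x = 5"
proof (induct x)
  case (of_int z)
  then have "0 \<le> z" "z < 5" by simp_all
  then have "z = 0 \<or> z = 1 \<or> z = 2 \<or> z = 3 \<or> z = 4" by arith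
  then show ?case by auto
qed

lemma forall_5: "(\<forall>i::5. P i) \<longleftrightarrow> P 1 \<and> P 2 \<and> P 3 \<and> P 4 \<and> P 5"
  by (metis exhaust_5)

lemma sum_5: "sum f (UNIV :: 5 set) = f 1 + f 2 + f 3 + f 4 + f 5"
proof -
  have "UNIV = {1, 2, 3, 4, 5 :: 5}"
    using exhaust_5 by auto
  then show ?thesis
    unfolding \<open>UNIV = {1, 2, 3, 4, 5 :: 5}\<close> by (simp add: ac_simps)
qed

lemma vector_5 [simp]:
  "(vector [a, b, c, d, e] :: 'a::zero ^ 5) $ 1 = a"
  "(vector [a, b, c, d, e] :: 'a::zero ^ 5) $ 2 = b"
  "(vector [a, b, c, d, e] :: 'a::zero ^ 5) $ 3 = c"
  "(vector [a, b, c, d, e] :: 'a::zero ^ 5) $ 4 = d"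
  "(vector [a, b, c, d, e] :: 'a::zero ^ 5) $ 5 = e"
  by (simp_all add: vector_def)

lemma galilean_matrix_linear:
  "galilean_matrix A v x t + galilean_matrix B w y s =
    galilean_matrix (A + B) (v + w) (x + y) (t + s)"
  "galilean_matrix A v x t - galilean_matrix B w y s =
    galilean_matrix (A - B) (v - w) (x - y) (t - s)"
  "c *\<^sub>R galilean_matrix A v x t = galilean_matrix (c *\<^sub>R A) (c *\<^sub>R v) (c *\<^sub>R x) (c * t)"
  by (simp_all add: galilean_matrix_def vec_eq_iff forall_5)

lemma galilean_matrix_eq_iff:
  "galilean_matrix A v x t = galilean_matrix B w y s \<longleftrightarrow> A = B \<and> v = w \<and> x = y \<and> t = s"
  by (auto simp: galilean_matrix_def vec_eq_iff forall_5 forall_3)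

lemma galilean_matrix_mult:
  "galilean_matrix A v x t ** galilean_matrix B w y s =
     galilean_matrix (A ** B) (A *v w) (A *v y + s *\<^sub>R v) 0"
  by (simp add: galilean_matrix_def vec_eq_iff forall_5 matrix_matrix_mult_def matrix_vector_mult_def
      sum_5 sum_3 mult.commute)

text \<open>The first pair is the Euclidean part (rotation, translation), the second holds the boost and the
time translation. The only bracket beyond the rotation action is that of boosts with time
translations, which produces space translations.\<close>

definition galilei_alg :: "(((real ^ 3) \<times> (real ^ 3)) \<times> ((real ^ 3) \<times> real)) lie_alg" where
  "galilei_alg =
     \<lparr>lie_carrier = UNIV,
      lie_bracket = (\<lambda>((a, x), (v, t)) ((b, y), (w, s)).
        ((twisted_cross 1 a b, twisted_cross 1 a y + twisted_cross 1 x b + s *\<^sub>R v - t *\<^sub>R w),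
         (twisted_cross 1 a w + twisted_cross 1 v b, 0)))\<rparr>"

definition galilei_J ::
  "((real ^ 3) \<times> (real ^ 3)) \<times> ((real ^ 3) \<times> real) \<Rightarrow> ((real ^ 3) \<times> (real ^ 3)) \<times> ((real ^ 3) \<times> real)" where
  "galilei_J = (\<lambda>(e, (v, t)). (orth_J e, (vector [- v $ 2, v $ 1, - t], v $ 3)))"

text \<open>Beyond the Euclidean part, the boosts \<open>v\<^sub>k\<close> and the time translation \<open>\<tau>\<close> contribute the
\<open>(1,0)\<close>-vectors \<open>v\<^sub>1 - i v\<^sub>2\<close> and \<open>v\<^sub>3 - i \<tau>\<close>. Their bracket is a multiple of \<open>f\<^sub>1 - i f\<^sub>2\<close>, with \<open>f\<^sub>k\<close> the
space translations. The latter commute with all \<open>v\<^sub>k\<close> and with \<open>\<tau>\<close>, the rotation \<open>e\<^sub>1 - i e\<^sub>2\<close> maps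
\<open>v\<^sub>1 - i v\<^sub>2\<close> to zero and \<open>v\<^sub>3 - i \<tau>\<close> to a multiple of \<open>v\<^sub>1 - i v\<^sub>2\<close>, and both are eigenvectors of \<open>e\<^sub>3\<close>.\<close>

lemma complex_structure_galilei_alg: "complex_structure galilei_alg galilei_J"
proof -
  have "real_lie_algebra galilei_alg"
    unfolding real_lie_algebra_def Let_def galilei_alg_def
    by (auto simp: linear_on_set_def vec3_eq_iff zero_prod_def algebra_simps)
  then show ?thesis
    unfolding complex_structure_def nijenhuis_def galilei_alg_def galilei_J_def orth_J_def
    by (auto simp: linear_on_set_def vec3_eq_iff zero_prod_def algebra_simps)
qed

definition galilei_to_matrix ::
  "((real ^ 3) \<times> (real ^ 3)) \<times> ((real ^ 3) \<times> real) \<Rightarrow> real ^ 5 ^ 5" where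
  "galilei_to_matrix = (\<lambda>((a, x), (v, t)). galilean_matrix (form_hat 1 a) v x t)"

lemma lie_iso_galilean: "lie_iso galilei_alg galilean galilei_to_matrix"
proof -
  have "galilean_matrix (form_hat 1 a) v x t \<in> range galilei_to_matrix" for a v x t
    by (rule range_eqI[of _ _ "((a, x), (v, t))"]) (simp add: galilei_to_matrix_def)
  then have "range galilei_to_matrix = lie_carrier galilean"
    unfolding galilean_def matrix_lie_alg_def so3_carrier lie_alg.simps
    by (auto simp: galilei_to_matrix_def)
  moreover have "inj galilei_to_matrix"
    by (auto simp: inj_def galilei_to_matrix_def galilean_matrix_eq_iff vec3_eq_iff)
  moreover have "galilei_to_matrix (lie_bracket galilei_alg X Y) =
      lie_bracket galilean (galilei_to_matrix X) (galilei_to_matrix Y)" for X Y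
    by (cases X; cases Y)
      (auto simp: galilei_to_matrix_def galilei_alg_def galilean_def matrix_lie_alg_def
        galilean_matrix_mult galilean_matrix_linear form_hat_mult form_hat_commutator
        galilean_matrix_eq_iff vec3_eq_iff algebra_simps)
  moreover have "linear galilei_to_matrix"
    by (rule linearI) (auto simp: galilei_to_matrix_def galilean_matrix_linear form_hat_linear)
  ultimately show ?thesis
    by (auto simp: lie_iso_def lie_hom_def galilei_alg_def linear_on_UNIV bij_betw_def)
qed

lemma holomorphic_orth_galilei:
  "holomorphic_lie_embedding (orth_alg 1 0) orth_J galilei_alg galilei_J (\<lambda>x. (x, 0))"
  by (auto simp: holomorphic_lie_embedding_def lie_hom_def linear_on_set_def orth_alg_def
      galilei_alg_def galilei_J_def inj_on_def vec3_eq_iff zero_prod_def)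

section \<open>The three complex structures\<close>

lemma deformation_of_orth:
  fixes \<eta> :: complex
  assumes "lie_iso (orth_alg \<epsilon> 0) g F" "\<eta>\<^sup>2 = of_real \<epsilon>" "\<eta> \<noteq> 0" "\<And>x. J (F x) = F (orth_J x)"
  shows "deformation_of (g :: 'a::euclidean_space lie_alg) J sl2C sl2C_J"
proof (rule deformation_ofI[where m = "orth_alg \<epsilon>" and J = orth_J and \<phi> = "orth_to_sl2C \<eta>" and F = F])
  show "continuous_on {0..1} (\<lambda>t. lie_bracket (orth_alg \<epsilon> t) x y)" for x y
    by (cases x; cases y) (auto simp: orth_alg_def intro!: continuous_intros)
qed (use assms lie_iso_sl2C complex_structure_orth_alg sl2C_J_intertwines in \<open>auto simp: orth_alg_def\<close>)

theorem proposition3p1: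
  "\<exists>J_e3 J_e21 J_gal.
     complex_structure e3 J_e3 \<and> complex_structure e21 J_e21 \<and> complex_structure galilean J_gal \<and>
     (\<exists>J_sl. regular_complex_structure sl2C J_sl \<and>
        deformation_of e3 J_e3 sl2C J_sl \<and> deformation_of e21 J_e21 sl2C J_sl) \<and>
     holomorphic_lie_embedding e3 J_e3 galilean J_gal e3_to_galilean"
proof -
  have UN [simp]: "lie_carrier (orth_alg \<epsilon> t) = UNIV" "lie_carrier galilei_alg = UNIV" for \<epsilon> t
    by (simp_all add: orth_alg_def galilei_alg_def)
  define F3 where "F3 = map_prod (form_hat 1) (id :: real ^ 3 \<Rightarrow> real ^ 3)"
  define F21 where "F21 = map_prod (form_hat (- 1)) (id :: real ^ 3 \<Rightarrow> real ^ 3)"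
  note F3 = lie_iso_e3[folded F3_def] and F21 = lie_iso_e21[folded F21_def] and G = lie_iso_galilean
  define J_e3 where "J_e3 = F3 \<circ> orth_J \<circ> inv F3"
  define J_e21 where "J_e21 = F21 \<circ> orth_J \<circ> inv F21"
  define J_gal where "J_gal = galilei_to_matrix \<circ> galilei_J \<circ> inv galilei_to_matrix"
  have inj: "inj F3" "inj F21" "inj galilei_to_matrix"
    using F3 F21 G by (auto simp: lie_iso_def bij_betw_def)
  have e3: "J_e3 (F3 x) = F3 (orth_J x)" for x
    using inj by (simp add: J_e3_def)
  have e21: "J_e21 (F21 x) = F21 (orth_J x)" for x
    using inj by (simp add: J_e21_def)
  have gal: "J_gal (galilei_to_matrix x) = galilei_to_matrix (galilei_J x)" for x
    using inj by (simp add: J_gal_def)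
  have "complex_structure e3 J_e3" "complex_structure e21 J_e21" "complex_structure galilean J_gal"
    using complex_structure_transport[OF complex_structure_orth_alg F3 e3]
      complex_structure_transport[OF complex_structure_orth_alg F21 e21]
      complex_structure_transport[OF complex_structure_galilei_alg G gal] by auto
  moreover have "deformation_of e3 J_e3 sl2C sl2C_J"
    using deformation_of_orth[OF F3, of 1] e3 by simp
  moreover have "deformation_of e21 J_e21 sl2C sl2C_J"
    using deformation_of_orth[OF F21, of \<i>] e21 by simp
  moreover have "holomorphic_lie_embedding e3 J_e3 galilean J_gal e3_to_galilean"
  proof (rule holomorphic_lie_embedding_transport[OF holomorphic_orth_galilei F3 G])
    show "real_lie_algebra (orth_alg 1 0)"
      using complex_structure_orth_alg by (auto simp: complex_structure_def)
    show "e3_to_galilean (F3 x) = galilei_to_matrix (x, 0)" for x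
      by (cases x) (simp add: e3_to_galilean_def F3_def galilei_to_matrix_def zero_prod_def)
  qed (auto simp: e3 gal)
  ultimately show ?thesis
    using regular_sl2C_J by blast
qed

end
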